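(* Let $G$ be a finite group acting on a finite nonempty set $X$, let $K$ be the classical Burnside kernel on $X$ and $Q$ the dual Burnside kernel on $G^*$. For every $\varepsilon\in(0,1)$, $$|t_{\mathrm{mix}}(Q;\varepsilon)-t_{\mathrm{mix}}(K;\varepsilon)|\le1.$$
   Context: For $g\in G$ and $x\in X$ write $X_g:=\{x\in X: g\cdot x=x\}$, $G_x:=\{g\in G: g\cdot x=x\}$, and $G^*:=\{g\in G: X_g\neq\varnothing\}$. The classical Burnside kernel on $X$ is $$K(x,y)=\frac1{|G_x|}\sum_{g\in G_x\cap G_y}\frac1{|X_g|},$$ with stationary law $\pi_K(x)=|G_x|/(|G|\,|X/G|)$; the dual Burnside kernel on $G^*$ is $$Q(g,h)=\frac1{|X_g|}\sum_{x\in X_g\cap X_h}\frac1{|G_x|},$$ with stationary law $\pi_Q(g)=|X_g|/(|G|\,|X/G|)$. For a kernel $P$ on a finite set $S$ with stationary law $\pi$, $d_P(t):=\max_{s\in S}\|P^t(s,\cdot)-\pi\|_{\mathrm{TV}}$ with $\|\mu-\nu\|_{\mathrm{TV}}=\frac12\sum_{s}|\mu(s)-\nu(s)|$, and $t_{\mathrm{mix}}(P;\varepsilon):=\min\{t\ge0:d_P(t)\le\varepsilon\}$ ($t$ an integer). *)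

theory Defs
  imports Complex_Main "HOL-Algebra.Group_Action"
begin

text \<open>
  A kernel on a finite set \<open>S\<close> is a function \<open>P :: 's \<Rightarrow> 's \<Rightarrow> real\<close> of which only the values on
  \<open>S \<times> S\<close> matter, and a law on \<open>S\<close> is a function of which only the values on \<open>S\<close> matter.
\<close>

fun kernel_pow :: "'s set \<Rightarrow> ('s \<Rightarrow> 's \<Rightarrow> real) \<Rightarrow> nat \<Rightarrow> 's \<Rightarrow> 's \<Rightarrow> real" where
  "kernel_pow S P 0 x y = (if x = y then 1 else 0)"
| "kernel_pow S P (Suc t) x y = (\<Sum>z\<in>S. kernel_pow S P t x z * P z y)"

definition tv_dist :: "'s set \<Rightarrow> ('s \<Rightarrow> real) \<Rightarrow> ('s \<Rightarrow> real) \<Rightarrow> real" where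
  "tv_dist S \<mu> \<nu> = 1/2 * (\<Sum>s\<in>S. \<bar>\<mu> s - \<nu> s\<bar>)"

definition mix_dist :: "'s set \<Rightarrow> ('s \<Rightarrow> 's \<Rightarrow> real) \<Rightarrow> ('s \<Rightarrow> real) \<Rightarrow> nat \<Rightarrow> real" where
  "mix_dist S P \<pi> t = Max ((\<lambda>s. tv_dist S (kernel_pow S P t s) \<pi>) ` S)"

text \<open>
  The minimum below is only meaningful if some \<open>t\<close> qualifies. For the two Burnside kernels of an
  action on a nonempty set this is the case for every \<open>\<epsilon> > 0\<close>: the identity fixes every point,
  so all entries of \<open>K\<close> and of \<open>Q\<^sup>2\<close> are positive and both chains converge.
\<close>

definition mixing_time ::
    "'s set \<Rightarrow> ('s \<Rightarrow> 's \<Rightarrow> real) \<Rightarrow> ('s \<Rightarrow> real) \<Rightarrow> real \<Rightarrow> nat" where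
  "mixing_time S P \<pi> \<epsilon> = (LEAST t. mix_dist S P \<pi> t \<le> \<epsilon>)"

text \<open>
  In the library's notation \<open>X\<^sub>g\<close> is \<open>invariants X \<phi> g\<close>, \<open>G\<^sub>x\<close> is \<open>stabilizer G \<phi> x\<close> and \<open>X/G\<close> is
  \<open>orbits G X \<phi>\<close>.
\<close>

definition fixing_elements ::
    "('g, 'm) monoid_scheme \<Rightarrow> 'x set \<Rightarrow> ('g \<Rightarrow> 'x \<Rightarrow> 'x) \<Rightarrow> 'g set" where
  "fixing_elements G X \<phi> = {g \<in> carrier G. invariants X \<phi> g \<noteq> {}}"

definition burnside_kernel ::
    "('g, 'm) monoid_scheme \<Rightarrow> 'x set \<Rightarrow> ('g \<Rightarrow> 'x \<Rightarrow> 'x) \<Rightarrow> 'x \<Rightarrow> 'x \<Rightarrow> real" where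
  "burnside_kernel G X \<phi> x y =
     1 / real (card (stabilizer G \<phi> x)) *
     (\<Sum>g \<in> stabilizer G \<phi> x \<inter> stabilizer G \<phi> y. 1 / real (card (invariants X \<phi> g)))"

definition burnside_law ::
    "('g, 'm) monoid_scheme \<Rightarrow> 'x set \<Rightarrow> ('g \<Rightarrow> 'x \<Rightarrow> 'x) \<Rightarrow> 'x \<Rightarrow> real" where
  "burnside_law G X \<phi> x =
     real (card (stabilizer G \<phi> x)) / (real (order G) * real (card (orbits G X \<phi>)))"

definition dual_burnside_kernel ::
    "('g, 'm) monoid_scheme \<Rightarrow> 'x set \<Rightarrow> ('g \<Rightarrow> 'x \<Rightarrow> 'x) \<Rightarrow> 'g \<Rightarrow> 'g \<Rightarrow> real" where
  "dual_burnside_kernel G X \<phi> g h =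
     1 / real (card (invariants X \<phi> g)) *
     (\<Sum>x \<in> invariants X \<phi> g \<inter> invariants X \<phi> h. 1 / real (card (stabilizer G \<phi> x)))"

definition dual_burnside_law ::
    "('g, 'm) monoid_scheme \<Rightarrow> 'x set \<Rightarrow> ('g \<Rightarrow> 'x \<Rightarrow> 'x) \<Rightarrow> 'g \<Rightarrow> real" where
  "dual_burnside_law G X \<phi> g =
     real (card (invariants X \<phi> g)) / (real (order G) * real (card (orbits G X \<phi>)))"

end

theory Submission
  imports Defs
begin

text \<open>
  One step of either chain is two half-steps: from \<open>x\<close> pick \<open>g\<close> uniformly in \<open>G\<^sub>x\<close> (a kernel \<open>A\<close>),
  and from \<open>g\<close> pick \<open>x\<close> uniformly in \<open>X\<^sub>g\<close> (a kernel \<open>B\<close>). Thus \<open>K = A B\<close> and \<open>Q = B A\<close>, while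
  \<open>\<pi>\<^sub>K A = \<pi>\<^sub>Q\<close> and \<open>\<pi>\<^sub>Q B = \<pi>\<^sub>K\<close>. Hence \<open>Q\<^bsup>t+1\<^esup> = B K\<^bsup>t\<^esup> A\<close>; averaging over rows and applying a
  stochastic kernel do not increase total variation, so \<open>d\<^sub>Q(t + 1) \<le> d\<^sub>K(t)\<close>, and symmetrically
  with \<open>K\<close> and \<open>Q\<close> exchanged. Both mixing times are attained because \<open>K\<close> has positive entries.
\<close>

section \<open>Stochastic kernels and total variation\<close>

text \<open>Source and target are separate sets because the half-steps pass between points and group
  elements.\<close>

definition stochastic_on :: "'s set \<Rightarrow> 't set \<Rightarrow> ('s \<Rightarrow> 't \<Rightarrow> real) \<Rightarrow> bool" where
  "stochastic_on S T A \<longleftrightarrow> (\<forall>x\<in>S. (\<forall>y\<in>T. 0 \<le> A x y) \<and> (\<Sum>y\<in>T. A x y) = 1)"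

text \<open>\<open>f\<close> is arbitrary, so the lemma serves rows of kernels, their powers and
  stationary laws alike.\<close>

lemma sum_push_forward:
  assumes "stochastic_on S T A"
  shows "(\<Sum>y\<in>T. \<Sum>x\<in>S. f x * A x y) = sum f S"
proof -
  have "(\<Sum>y\<in>T. \<Sum>x\<in>S. f x * A x y) = (\<Sum>x\<in>S. f x * (\<Sum>y\<in>T. A x y))"
    by (subst sum.swap) (simp add: sum_distrib_left)
  then show ?thesis
    using assms by (simp add: stochastic_on_def)
qed

lemma kernel_pow_row_sum:
  assumes "finite S" and "stochastic_on S S P" and "x \<in> S"
  shows "(\<Sum>y\<in>S. kernel_pow S P t x y) = 1"
proof (induction t)
  case (Suc t)
  then show ?case
    using sum_push_forward[OF assms(2), of "kernel_pow S P t x"] by simp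
qed (use assms in simp)

text \<open>Subtracting the constant \<open>c\<close> from \<open>A\<close> does not affect the image of a signed measure of mass zero.\<close>

lemma tv_dist_push_forward:
  assumes "stochastic_on S T A"
    and lower: "\<And>x y. x \<in> S \<Longrightarrow> y \<in> T \<Longrightarrow> c \<le> A x y"
    and mass: "sum f S = sum g S"
  shows "tv_dist T (\<lambda>y. \<Sum>x\<in>S. f x * A x y) (\<lambda>y. \<Sum>x\<in>S. g x * A x y)
           \<le> (1 - c * real (card T)) * tv_dist S f g"
proof -
  have "(\<Sum>y\<in>T. \<bar>(\<Sum>x\<in>S. f x * A x y) - (\<Sum>x\<in>S. g x * A x y)\<bar>)
          \<le> (\<Sum>y\<in>T. \<Sum>x\<in>S. \<bar>f x - g x\<bar> * (A x y - c))"
  proof (rule sum_mono)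
    fix y assume y: "y \<in> T"
    have "(\<Sum>x\<in>S. f x * A x y) - (\<Sum>x\<in>S. g x * A x y) = (\<Sum>x\<in>S. (f x - g x) * (A x y - c))"
      using mass by (simp add: algebra_simps sum.distrib sum_subtractf flip: sum_distrib_left)
    also have "\<bar>\<dots>\<bar> \<le> (\<Sum>x\<in>S. \<bar>(f x - g x) * (A x y - c)\<bar>)"
      by (rule sum_abs)
    also have "\<dots> = (\<Sum>x\<in>S. \<bar>f x - g x\<bar> * (A x y - c))"
      using lower y by (intro sum.cong) (auto simp: abs_mult)
    finally show "\<bar>(\<Sum>x\<in>S. f x * A x y) - (\<Sum>x\<in>S. g x * A x y)\<bar>
        \<le> (\<Sum>x\<in>S. \<bar>f x - g x\<bar> * (A x y - c))" .
  qed
  also have "\<dots> = (\<Sum>x\<in>S. \<bar>f x - g x\<bar> * (\<Sum>y\<in>T. A x y - c))"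
    by (subst sum.swap) (simp add: sum_distrib_left)
  also have "\<dots> = (\<Sum>x\<in>S. \<bar>f x - g x\<bar> * (1 - c * real (card T)))"
    using assms(1) by (intro sum.cong) (auto simp: stochastic_on_def sum_subtractf)
  also have "\<dots> = (1 - c * real (card T)) * (\<Sum>x\<in>S. \<bar>f x - g x\<bar>)"
    by (simp add: mult.commute flip: sum_distrib_right)
  finally show ?thesis
    by (simp add: tv_dist_def)
qed

text \<open>Convexity of total variation in its first argument: since the weights sum to 1,
  \<open>\<nu> y\<close> moves inside the mixture and the triangle inequality applies.\<close>

lemma tv_dist_mixture:
  assumes "\<And>x. x \<in> S \<Longrightarrow> 0 \<le> w x" and "sum w S = 1"
    and bound: "\<And>x. x \<in> S \<Longrightarrow> tv_dist T (F x) \<nu> \<le> d"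
  shows "tv_dist T (\<lambda>y. \<Sum>x\<in>S. w x * F x y) \<nu> \<le> d"
proof -
  have "tv_dist T (\<lambda>y. \<Sum>x\<in>S. w x * F x y) \<nu> = 1/2 * (\<Sum>y\<in>T. \<bar>\<Sum>x\<in>S. w x * (F x y - \<nu> y)\<bar>)"
    using assms(2) by (simp add: tv_dist_def right_diff_distrib sum_subtractf flip: sum_distrib_right)
  also have "\<dots> \<le> 1/2 * (\<Sum>y\<in>T. \<Sum>x\<in>S. w x * \<bar>F x y - \<nu> y\<bar>)"
    using assms(1)
    by (intro mult_left_mono sum_mono order.trans[OF sum_abs]) (auto simp: abs_mult)
  also have "\<dots> = (\<Sum>x\<in>S. w x * tv_dist T (F x) \<nu>)"
    by (subst sum.swap) (simp add: tv_dist_def sum_distrib_left mult_ac)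
  also have "\<dots> \<le> (\<Sum>x\<in>S. w x * d)"
    using assms by (intro sum_mono mult_left_mono) auto
  also have "\<dots> = d"
    using assms(2) by (simp flip: sum_distrib_right)
  finally show ?thesis .
qed

lemma tv_dist_cong:
  assumes "\<And>s. s \<in> S \<Longrightarrow> \<mu> s = \<mu>' s" and "\<And>s. s \<in> S \<Longrightarrow> \<nu> s = \<nu>' s"
  shows "tv_dist S \<mu> \<nu> = tv_dist S \<mu>' \<nu>'"
  using assms by (simp add: tv_dist_def)

lemma mix_dist_leI:
  assumes "finite S" and "S \<noteq> {}"
    and "\<And>s. s \<in> S \<Longrightarrow> tv_dist S (kernel_pow S P t s) \<pi> \<le> d"
  shows "mix_dist S P \<pi> t \<le> d"
  using assms by (simp add: mix_dist_def)

lemma tv_dist_le_mix_dist: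
  assumes "finite S" and "s \<in> S"
  shows "tv_dist S (kernel_pow S P t s) \<pi> \<le> mix_dist S P \<pi> t"
  using assms by (simp add: mix_dist_def)

section \<open>Convergence of kernels with positive entries\<close>

text \<open>Doeblin's argument: the uniform lower bound \<open>c\<close> makes each step contract
  the distance to \<open>\<pi>\<close> by the factor \<open>1 - c * real (card S)\<close>. It serves
  to show that the least time in \<open>mixing_time\<close> is attained.\<close>

lemma mix_dist_positive_kernel_tendsto_0:
  assumes fin: "finite S" and ne: "S \<noteq> {}" and P: "stochastic_on S S P"
    and c: "0 < c" "\<And>x y. x \<in> S \<Longrightarrow> y \<in> S \<Longrightarrow> c \<le> P x y"
    and mass: "sum \<pi> S = 1"
    and stat: "\<And>y. y \<in> S \<Longrightarrow> (\<Sum>x\<in>S. \<pi> x * P x y) = \<pi> y"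
  shows "mix_dist S P \<pi> \<longlonglongrightarrow> 0"
proof -
  let ?r = "1 - c * real (card S)"
  have r: "0 \<le> ?r" "?r < 1"
  proof -
    obtain x where x: "x \<in> S"
      using ne by blast
    have "c * real (card S) = (\<Sum>y\<in>S. c)"
      by simp
    also have "\<dots> \<le> (\<Sum>y\<in>S. P x y)"
      using c(2) x by (intro sum_mono) auto
    also have "\<dots> = 1"
      using P x by (simp add: stochastic_on_def)
    finally show "0 \<le> ?r"
      by simp
    show "?r < 1"
      using c(1) fin ne by (simp add: card_gt_0_iff)
  qed
  have decay: "tv_dist S (kernel_pow S P t s) \<pi> \<le> ?r ^ t * mix_dist S P \<pi> 0" if s: "s \<in> S" for s t
  proof (induction t)
    case 0
    show ?case
      using tv_dist_le_mix_dist[OF fin s, of P 0 \<pi>] by (simp del: kernel_pow.simps)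
  next
    case (Suc t)
    \<comment> \<open>Stationarity replaces \<open>\<pi>\<close> by its own image under
      \<open>P\<close>, so that two images are compared.\<close>
    have "tv_dist S (kernel_pow S P (Suc t) s) \<pi>
        = tv_dist S (\<lambda>y. \<Sum>x\<in>S. kernel_pow S P t s x * P x y) (\<lambda>y. \<Sum>x\<in>S. \<pi> x * P x y)"
      using stat by (intro tv_dist_cong) auto
    also have "\<dots> \<le> ?r * tv_dist S (kernel_pow S P t s) \<pi>"
      using c(2) mass kernel_pow_row_sum[OF fin P s] by (intro tv_dist_push_forward[OF P]) auto
    also have "\<dots> \<le> ?r * (?r ^ t * mix_dist S P \<pi> 0)"
      using Suc r(1) by (rule mult_left_mono)
    finally show ?case
      by (simp only: power_Suc mult.assoc)
  qed
  have upper: "mix_dist S P \<pi> t \<le> ?r ^ t * mix_dist S P \<pi> 0" for t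
    using decay by (intro mix_dist_leI[OF fin ne])
  have lower: "0 \<le> mix_dist S P \<pi> t" for t
  proof -
    obtain s where "s \<in> S"
      using ne by blast
    have "0 \<le> tv_dist S (kernel_pow S P t s) \<pi>"
      by (simp add: tv_dist_def sum_nonneg)
    then show ?thesis
      using tv_dist_le_mix_dist[OF fin \<open>s \<in> S\<close>, of P t \<pi>] by linarith
  qed
  have "(\<lambda>t. ?r ^ t) \<longlonglongrightarrow> 0"
    using r by (intro LIMSEQ_power_zero) simp
  then have lim: "(\<lambda>t. ?r ^ t * mix_dist S P \<pi> 0) \<longlonglongrightarrow> 0"
    by (rule tendsto_mult_left_zero)
  show ?thesis
    by (rule tendsto_sandwich[OF always_eventually always_eventually tendsto_const lim])
      (use upper lower in blast)+
qed

section \<open>Products of two kernels in either order\<close>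

text \<open>Associativity alone: a power of BA, with its outer B and A split off, is a power of AB
  with exponent one less. The induction peels off the last factor, as \<open>kernel_pow\<close>
  does, and needs the hypothesis at every intermediate state, hence the generalization over
  \<open>h\<close>.\<close>

lemma kernel_pow_Suc_swapped_product:
  assumes fin: "finite S" "finite T"
    and P: "\<And>x y. x \<in> S \<Longrightarrow> y \<in> S \<Longrightarrow> P x y = (\<Sum>g\<in>T. A x g * B g y)"
    and Q: "\<And>g h. g \<in> T \<Longrightarrow> h \<in> T \<Longrightarrow> Q g h = (\<Sum>x\<in>S. B g x * A x h)"
    and "g \<in> T" and "h \<in> T"
  shows "kernel_pow T Q (Suc t) g h = (\<Sum>x\<in>S. B g x * (\<Sum>y\<in>S. kernel_pow S P t x y * A y h))"
  using \<open>h \<in> T\<close>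
proof (induction t arbitrary: h)
  case 0
  have "kernel_pow T Q (Suc 0) g h = (\<Sum>z\<in>T. if g = z then Q z h else 0)"
    by (auto intro: sum.cong)
  also have "\<dots> = Q g h"
    using fin \<open>g \<in> T\<close> by simp
  also have "\<dots> = (\<Sum>x\<in>S. B g x * (\<Sum>y\<in>S. if x = y then A y h else 0))"
    using Q[OF \<open>g \<in> T\<close> \<open>h \<in> T\<close>] fin by simp
  also have "\<dots> = (\<Sum>x\<in>S. B g x * (\<Sum>y\<in>S. kernel_pow S P 0 x y * A y h))"
    by (auto intro!: sum.cong arg_cong2[where f = "(*)"])
  finally show ?case .
next
  case (Suc t)
  let ?p = "kernel_pow S P t"
  have "kernel_pow T Q (Suc (Suc t)) g h
      = (\<Sum>z\<in>T. kernel_pow T Q (Suc t) g z * Q z h)"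
    by simp
  also have "\<dots> = (\<Sum>z\<in>T. (\<Sum>x\<in>S. B g x * (\<Sum>u\<in>S. ?p x u * A u z)) * (\<Sum>y\<in>S. B z y * A y h))"
    by (intro sum.cong refl arg_cong2[where f = "(*)"] Suc.IH Q Suc.prems)
  also have "\<dots> = (\<Sum>z\<in>T. \<Sum>x\<in>S. \<Sum>u\<in>S. \<Sum>y\<in>S. B g x * ?p x u * A u z * B z y * A y h)"
    by (simp add: sum_product sum_distrib_left sum_distrib_right mult_ac)
  \<comment> \<open>The sum over \<open>z\<close> moves innermost, where
    \<open>A u z * B z y\<close> collapses to \<open>P u y\<close>.\<close>
  also have "\<dots> = (\<Sum>x\<in>S. \<Sum>u\<in>S. \<Sum>y\<in>S. \<Sum>z\<in>T. B g x * ?p x u * A u z * B z y * A y h)"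
    apply (rule trans[OF sum.swap])
    apply (rule sum.cong[OF refl])
    apply (rule trans[OF sum.swap])
    apply (rule sum.cong[OF refl])
    apply (rule sum.swap)
    done
  also have "\<dots> = (\<Sum>x\<in>S. \<Sum>u\<in>S. \<Sum>y\<in>S. B g x * (?p x u * P u y * A y h))"
    by (intro sum.cong refl) (simp add: P sum_distrib_left sum_distrib_right mult_ac)
  also have "\<dots> = (\<Sum>x\<in>S. \<Sum>y\<in>S. \<Sum>u\<in>S. B g x * (?p x u * P u y * A y h))"
    by (rule sum.cong[OF refl]) (rule sum.swap)
  also have "\<dots> = (\<Sum>x\<in>S. B g x * (\<Sum>y\<in>S. kernel_pow S P (Suc t) x y * A y h))"
    by (simp add: sum_distrib_left sum_distrib_right)
  finally show ?case .
qed

text \<open>Row \<open>g\<close> of the power of \<open>Q\<close> is the mixture, with weights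
  \<open>B g x\<close>, of the \<open>A\<close>-images of rows of the power of \<open>P\<close>. The
  kernels are abstract so that the two Burnside chains can take either role.\<close>

lemma mix_dist_swapped_product_le:
  assumes fin: "finite S" "finite T" and "T \<noteq> {}"
    and A: "stochastic_on S T A" and B: "stochastic_on T S B"
    and P: "\<And>x y. x \<in> S \<Longrightarrow> y \<in> S \<Longrightarrow> P x y = (\<Sum>g\<in>T. A x g * B g y)"
    and Q: "\<And>g h. g \<in> T \<Longrightarrow> h \<in> T \<Longrightarrow> Q g h = (\<Sum>x\<in>S. B g x * A x h)"
    and \<nu>: "\<And>h. h \<in> T \<Longrightarrow> (\<Sum>x\<in>S. \<mu> x * A x h) = \<nu> h"
    and mass: "sum \<mu> S = 1"
  shows "mix_dist T Q \<nu> (Suc t) \<le> mix_dist S P \<mu> t"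
proof (rule mix_dist_leI)
  fix g assume g: "g \<in> T"
  have "stochastic_on S S P"
  proof -
    have "(\<Sum>y\<in>S. P x y) = 1" if "x \<in> S" for x
      using sum_push_forward[OF B, of "A x"] A P that by (simp add: stochastic_on_def)
    then show ?thesis
      using A B P by (auto simp: stochastic_on_def intro!: sum_nonneg)
  qed
  then have row: "(\<Sum>y\<in>S. kernel_pow S P t x y) = 1" if "x \<in> S" for x
    using kernel_pow_row_sum fin that by metis
  have "tv_dist T (\<lambda>h. \<Sum>y\<in>S. kernel_pow S P t x y * A y h) \<nu> \<le> mix_dist S P \<mu> t"
    if x: "x \<in> S" for x
  proof -
    have "tv_dist T (\<lambda>h. \<Sum>y\<in>S. kernel_pow S P t x y * A y h) \<nu>
        = tv_dist T (\<lambda>h. \<Sum>y\<in>S. kernel_pow S P t x y * A y h) (\<lambda>h. \<Sum>y\<in>S. \<mu> y * A y h)"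
      using \<nu> by (intro tv_dist_cong) auto
    \<comment> \<open>Half-steps may have zero entries, so the lower bound is 0 and the factor is
      1.\<close>
    also have "\<dots> \<le> (1 - 0 * real (card T)) * tv_dist S (kernel_pow S P t x) \<mu>"
      using A row[OF x] mass by (intro tv_dist_push_forward) (auto simp: stochastic_on_def)
    also have "\<dots> \<le> mix_dist S P \<mu> t"
      using tv_dist_le_mix_dist[OF fin(1) x] by simp
    finally show ?thesis .
  qed
  then have "tv_dist T (\<lambda>h. \<Sum>x\<in>S. B g x * (\<Sum>y\<in>S. kernel_pow S P t x y * A y h)) \<nu>
      \<le> mix_dist S P \<mu> t"
    using B g by (intro tv_dist_mixture[where F = "\<lambda>x h. \<Sum>y\<in>S. kernel_pow S P t x y * A y h"])
      (auto simp: stochastic_on_def)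
  also have "tv_dist T (\<lambda>h. \<Sum>x\<in>S. B g x * (\<Sum>y\<in>S. kernel_pow S P t x y * A y h)) \<nu>
      = tv_dist T (kernel_pow T Q (Suc t) g) \<nu>"
    using kernel_pow_Suc_swapped_product[where P = P and Q = Q, OF fin P Q g]
    by (intro tv_dist_cong) auto
  finally show "tv_dist T (kernel_pow T Q (Suc t) g) \<nu> \<le> mix_dist S P \<mu> t" .
qed (rule fin \<open>T \<noteq> {}\<close>)+

text \<open>The witness \<open>t\<close> ensures that the least time for \<open>p\<close> really
  satisfies \<open>p\<close>; its successor then satisfies \<open>q\<close>.\<close>

lemma Least_le_Suc_Least:
  fixes p q :: "nat \<Rightarrow> bool"
  assumes "p t" and "\<And>t. p t \<Longrightarrow> q (Suc t)"
  shows "(LEAST t. q t) \<le> Suc (LEAST t. p t)"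
  using assms by (metis LeastI Least_le)

section \<open>The half-steps of the Burnside chains and their laws\<close>

text \<open>The half-step \<open>A\<close> of the overview. It shares the test
  \<open>\<phi> g x = x\<close> with the half-step \<open>B\<close>, so that products become sums
  over fixed pairs; for \<open>g\<close> in the carrier the test means membership in the
  stabilizer.\<close>

definition stabilizer_kernel ::
    "('g, 'm) monoid_scheme \<Rightarrow> ('g \<Rightarrow> 'x \<Rightarrow> 'x) \<Rightarrow> 'x \<Rightarrow> 'g \<Rightarrow> real" where
  "stabilizer_kernel G \<phi> x g = (if \<phi> g x = x then 1 / real (card (stabilizer G \<phi> x)) else 0)"

definition invariants_kernel :: "'x set \<Rightarrow> ('g \<Rightarrow> 'x \<Rightarrow> 'x) \<Rightarrow> 'g \<Rightarrow> 'x \<Rightarrow> real" where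
  "invariants_kernel X \<phi> g x = (if \<phi> g x = x then 1 / real (card (invariants X \<phi> g)) else 0)"

context group_action
begin

text \<open>A point fixed by \<open>g\<close> witnesses that \<open>invariants E \<phi> g\<close> is
  nonempty, so whole stabilizers lie in the state space of the dual chain.\<close>

lemma stabilizer_eq_fixing_elements:
  "x \<in> E \<Longrightarrow> stabilizer G \<phi> x = {g \<in> fixing_elements G E \<phi>. \<phi> g x = x}"
  by (auto simp: stabilizer_def fixing_elements_def invariants_def)

lemma card_stabilizer_pos:
  assumes "finite (carrier G)" and "x \<in> E"
  shows "0 < card (stabilizer G \<phi> x)"
  using stabilizer_one_closed[OF assms(2)] stabilizer_subset[of x] assms(1)
  by (metis card_gt_0_iff empty_iff finite_subset)

lemma stabilizer_kernel_stochastic: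
  assumes "finite (carrier G)"
  shows "stochastic_on E (fixing_elements G E \<phi>) (stabilizer_kernel G \<phi>)"
  unfolding stochastic_on_def
proof (intro ballI conjI)
  fix x assume x: "x \<in> E"
  have "finite (fixing_elements G E \<phi>)"
    using assms by (simp add: fixing_elements_def)
  moreover have "card (stabilizer G \<phi> x) \<noteq> 0"
    using card_stabilizer_pos[OF assms x] by simp
  ultimately show "(\<Sum>g\<in>fixing_elements G E \<phi>. stabilizer_kernel G \<phi> x g) = 1"
    by (simp add: stabilizer_kernel_def stabilizer_eq_fixing_elements[OF x] flip: sum.inter_filter)
qed (simp add: stabilizer_kernel_def)

text \<open>Restricting to \<open>fixing_elements\<close> makes the fixed-point sets nonempty; for
  any other \<open>g\<close> the row would vanish.\<close>

lemma invariants_kernel_stochastic: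
  assumes "finite E"
  shows "stochastic_on (fixing_elements G E \<phi>) E (invariants_kernel E \<phi>)"
  unfolding stochastic_on_def
proof (intro ballI conjI)
  fix g assume "g \<in> fixing_elements G E \<phi>"
  then have "card (invariants E \<phi> g) \<noteq> 0"
    using assms by (simp add: fixing_elements_def invariants_def)
  then show "(\<Sum>x\<in>E. invariants_kernel E \<phi> g x) = 1"
    using assms by (simp add: invariants_kernel_def invariants_def flip: sum.inter_filter)
qed (simp add: invariants_kernel_def)

text \<open>Both sides add the weight 1/(|G_x| |X_g|) over the \<open>g\<close> fixing both
  points.\<close>

lemma burnside_kernel_factorization:
  assumes "finite (carrier G)" and "x \<in> E" and "y \<in> E"
  shows "burnside_kernel G E \<phi> x y
    = (\<Sum>g\<in>fixing_elements G E \<phi>. stabilizer_kernel G \<phi> x g * invariants_kernel E \<phi> g y)"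
proof -
  have fin: "finite (fixing_elements G E \<phi>)"
    using assms by (simp add: fixing_elements_def)
  have "stabilizer G \<phi> x \<inter> stabilizer G \<phi> y
      = {g \<in> fixing_elements G E \<phi>. \<phi> g x = x \<and> \<phi> g y = y}"
    using assms by (auto simp: stabilizer_eq_fixing_elements)
  then show ?thesis
    by (auto simp: burnside_kernel_def sum_distrib_left stabilizer_kernel_def invariants_kernel_def
        sum.inter_filter[OF fin] intro!: sum.cong)
qed

lemma dual_burnside_kernel_factorization:
  assumes "finite E"
  shows "dual_burnside_kernel G E \<phi> g h
    = (\<Sum>x\<in>E. invariants_kernel E \<phi> g x * stabilizer_kernel G \<phi> x h)"
proof -
  have "invariants E \<phi> g \<inter> invariants E \<phi> h = {x \<in> E. \<phi> g x = x \<and> \<phi> h x = x}"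
    by (auto simp: invariants_def)
  then show ?thesis
    by (auto simp: dual_burnside_kernel_def sum_distrib_left stabilizer_kernel_def
        invariants_kernel_def sum.inter_filter[OF assms] intro!: sum.cong)
qed

text \<open>The factor |G_x| cancels, leaving the same mass 1/(|G| |X/G|) on every pair with
  \<open>\<phi> g x = x\<close>. The two stationary laws are the marginals of this uniform law on
  pairs.\<close>

lemma burnside_law_push_forward:
  assumes "finite (carrier G)" and "finite E"
  shows "(\<Sum>x\<in>E. burnside_law G E \<phi> x * stabilizer_kernel G \<phi> x g) = dual_burnside_law G E \<phi> g"
proof -
  have "(\<Sum>x\<in>E. burnside_law G E \<phi> x * stabilizer_kernel G \<phi> x g)
      = (\<Sum>x\<in>E. if \<phi> g x = x then 1 / (real (order G) * real (card (orbits G E \<phi>))) else 0)"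
  proof (rule sum.cong[OF refl])
    fix x assume "x \<in> E"
    then have "card (stabilizer G \<phi> x) \<noteq> 0"
      using card_stabilizer_pos[OF assms(1)] by (metis less_irrefl)
    then show "burnside_law G E \<phi> x * stabilizer_kernel G \<phi> x g
        = (if \<phi> g x = x then 1 / (real (order G) * real (card (orbits G E \<phi>))) else 0)"
      by (simp add: burnside_law_def stabilizer_kernel_def)
  qed
  then show ?thesis
    using assms(2)
    by (simp add: dual_burnside_law_def invariants_def flip: sum.inter_filter)
qed

lemma dual_burnside_law_push_forward:
  assumes "finite (carrier G)" and "finite E" and "x \<in> E"
  shows "(\<Sum>g\<in>fixing_elements G E \<phi>. dual_burnside_law G E \<phi> g * invariants_kernel E \<phi> g x)
    = burnside_law G E \<phi> x"
proof -
  have "(\<Sum>g\<in>fixing_elements G E \<phi>. dual_burnside_law G E \<phi> g * invariants_kernel E \<phi> g x)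
      = (\<Sum>g\<in>fixing_elements G E \<phi>.
          if \<phi> g x = x then 1 / (real (order G) * real (card (orbits G E \<phi>))) else 0)"
    using assms(2)
    by (intro sum.cong) (auto simp: dual_burnside_law_def invariants_kernel_def fixing_elements_def
        invariants_def)
  moreover have "finite (fixing_elements G E \<phi>)"
    using assms(1) by (simp add: fixing_elements_def)
  ultimately show ?thesis
    by (simp add: burnside_law_def stabilizer_eq_fixing_elements[OF assms(3)]
        flip: sum.inter_filter)
qed

text \<open>This is Burnside's orbit-counting lemma; elements without fixed points add nothing to
  its sum.\<close>

lemma dual_burnside_law_sum:
  assumes "finite (carrier G)" and "finite E" and "E \<noteq> {}"
  shows "sum (dual_burnside_law G E \<phi>) (fixing_elements G E \<phi>) = 1"
proof -
  have "(\<Sum>g\<in>fixing_elements G E \<phi>. real (card (invariants E \<phi> g)))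
      = (\<Sum>g\<in>carrier G. real (card (invariants E \<phi> g)))"
    using assms(1) by (intro sum.mono_neutral_left) (auto simp: fixing_elements_def)
  also have "\<dots> = real (card (orbits G E \<phi>)) * real (order G)"
    using burnside[OF assms(1,2)] by (metis of_nat_mult of_nat_sum)
  finally have *: "(\<Sum>g\<in>fixing_elements G E \<phi>. real (card (invariants E \<phi> g)))
      = real (card (orbits G E \<phi>)) * real (order G)" .
  \<comment> \<open>As an image of \<open>E\<close>, the set of orbits is finite and nonempty, so
    the denominator of the law is nonzero.\<close>
  have "orbits G E \<phi> = orbit G \<phi> ` E"
    by (auto simp: orbits_def)
  then have "card (orbits G E \<phi>) \<noteq> 0"
    using assms by simp
  moreover have "order G \<noteq> 0"
    using assms(1) group.is_monoid[OF group_hom.axioms(1)[OF group_hom]]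
    by (metis monoid.order_gt_0_iff_finite less_irrefl)
  ultimately show ?thesis
    using * by (simp add: dual_burnside_law_def mult.commute flip: sum_divide_distrib)
qed

text \<open>Stochastic kernels preserve mass, so the normalization is inherited from the dual
  law.\<close>

lemma burnside_law_sum:
  assumes "finite (carrier G)" and "finite E" and "E \<noteq> {}"
  shows "sum (burnside_law G E \<phi>) E = 1"
  using sum_push_forward[OF invariants_kernel_stochastic[OF assms(2)], of "dual_burnside_law G E \<phi>"]
  by (simp add: dual_burnside_law_push_forward dual_burnside_law_sum assms)

text \<open>The identity contributes \<open>1 / (|G\<^sub>x| |X|)\<close> to every entry.\<close>

lemma burnside_kernel_lower_bound:
  assumes "finite (carrier G)" and "finite E" and "x \<in> E" and "y \<in> E"
  shows "1 / (real (order G) * real (card E)) \<le> burnside_kernel G E \<phi> x y"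
proof -
  let ?S = "stabilizer G \<phi> x"
  have fin: "finite ?S"
    using stabilizer_subset assms(1) by (rule finite_subset)
  have "card ?S \<le> order G"
    unfolding order_def using stabilizer_subset assms(1) by (intro card_mono)
  moreover have "0 < card ?S"
    using card_stabilizer_pos assms by blast
  moreover have "0 < card E"
    using assms by (auto simp: card_gt_0_iff)
  ultimately have "1 / (real (order G) * real (card E)) \<le> 1 / real (card ?S) * (1 / real (card E))"
    by (simp add: frac_le)
  also have "1 / real (card E) = 1 / real (card (invariants E \<phi> \<one>))"
    using stabilizer_one_closed by (auto simp: invariants_def stabilizer_def intro!: arg_cong[where f = card])
  also have "\<dots> \<le> (\<Sum>g\<in>?S \<inter> stabilizer G \<phi> y. 1 / real (card (invariants E \<phi> g)))"
    using stabilizer_one_closed assms fin by (intro member_le_sum) auto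
  finally show ?thesis
    by (simp add: burnside_kernel_def mult_left_mono divide_right_mono)
qed

end

theorem theorem3p16:
  fixes G :: "('g, 'm) monoid_scheme" and X :: "'x set"
    and \<phi> :: "'g \<Rightarrow> 'x \<Rightarrow> 'x" and \<epsilon> :: real
  assumes "group_action G X \<phi>"
    and "finite (carrier G)"
    and "finite X" and "X \<noteq> {}"
    and "0 < \<epsilon>" and "\<epsilon> < 1"
  shows "\<bar>int (mixing_time (fixing_elements G X \<phi>)
                 (dual_burnside_kernel G X \<phi>) (dual_burnside_law G X \<phi>) \<epsilon>)
          - int (mixing_time X (burnside_kernel G X \<phi>) (burnside_law G X \<phi>) \<epsilon>)\<bar> \<le> 1"
proof -
  interpret group_action G X \<phi>
    by fact
  let ?T = "fixing_elements G X \<phi>"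
  let ?A = "stabilizer_kernel G \<phi>" and ?B = "invariants_kernel X \<phi>"
  let ?K = "burnside_kernel G X \<phi>" and ?Q = "dual_burnside_kernel G X \<phi>"
  let ?\<mu> = "burnside_law G X \<phi>" and ?\<nu> = "dual_burnside_law G X \<phi>"
  note A = stabilizer_kernel_stochastic[OF assms(2)]
  note B = invariants_kernel_stochastic[OF assms(3)]
  note K = burnside_kernel_factorization[OF assms(2)]
  note Q = dual_burnside_kernel_factorization[OF assms(3)]
  note \<nu> = burnside_law_push_forward[OF assms(2,3)]
  note \<mu> = dual_burnside_law_push_forward[OF assms(2,3)]
  have T: "finite ?T" "?T \<noteq> {}"
  proof -
    show "finite ?T"
      using assms(2) by (simp add: fixing_elements_def)
    \<comment> \<open>An empty state space would give the dual law total mass 0 instead of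
      1.\<close>
    show "?T \<noteq> {}"
      using dual_burnside_law_sum[OF assms(2-4)] by (rule contrapos_pn) simp
  qed
  have QK: "mix_dist ?T ?Q ?\<nu> (Suc t) \<le> mix_dist X ?K ?\<mu> t" for t
    by (rule mix_dist_swapped_product_le[OF assms(3) T A B K Q \<nu> burnside_law_sum])
      (use assms in auto)
  \<comment> \<open>The same lemma with the roles of the two chains exchanged.\<close>
  have KQ: "mix_dist X ?K ?\<mu> (Suc t) \<le> mix_dist ?T ?Q ?\<nu> t" for t
    by (rule mix_dist_swapped_product_le[OF T(1) assms(3,4) B A Q K \<mu> dual_burnside_law_sum])
      (use assms in auto)
  \<comment> \<open>Convergence is proved for \<open>?K\<close>, whose entries are all positive;
    \<open>?Q g h\<close> vanishes when \<open>g\<close> and \<open>h\<close> have no common fixed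
    point.\<close>
  have "mix_dist X ?K ?\<mu> \<longlonglongrightarrow> 0"
  proof (rule mix_dist_positive_kernel_tendsto_0)
    have "(\<Sum>y\<in>X. ?K x y) = 1" if "x \<in> X" for x
      using sum_push_forward[OF B, of "?A x"] A that by (simp add: K stochastic_on_def)
    then show "stochastic_on X X ?K"
      by (auto simp: stochastic_on_def burnside_kernel_def sum_nonneg)
    show "(\<Sum>x\<in>X. ?\<mu> x * ?K x y) = ?\<mu> y" if "y \<in> X" for y
    proof -
      \<comment> \<open>Stationarity passes through the other chain: \<open>?A\<close> carries
        \<open>?\<mu>\<close> to \<open>?\<nu>\<close>, and \<open>?B\<close> carries it
        back.\<close>
      have "(\<Sum>x\<in>X. ?\<mu> x * ?K x y) = (\<Sum>x\<in>X. \<Sum>g\<in>?T. ?\<mu> x * ?A x g * ?B g y)"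
        using that by (intro sum.cong) (auto simp: K sum_distrib_left mult_ac)
      also have "\<dots> = (\<Sum>g\<in>?T. (\<Sum>x\<in>X. ?\<mu> x * ?A x g) * ?B g y)"
        by (subst sum.swap) (simp add: sum_distrib_right)
      also have "\<dots> = ?\<mu> y"
        using \<mu>[OF that] by (simp add: \<nu>)
      finally show ?thesis .
    qed
    have "order G \<noteq> 0"
      using card_stabilizer_pos[OF assms(2)] stabilizer_subset assms(2,4)
      by (metis card_0_eq card_mono ex_in_conv gr_implies_not0 le_zero_eq order_def)
    then show "0 < 1 / (real (order G) * real (card X))"
      using assms(3,4) by (simp add: card_gt_0_iff)
  qed (use assms burnside_kernel_lower_bound burnside_law_sum in auto)
  then obtain t where t: "mix_dist X ?K ?\<mu> t \<le> \<epsilon>"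
    using \<open>0 < \<epsilon>\<close> by (metis eventually_sequentially order.refl order_less_imp_le order_tendstoD(2))
  have "mixing_time ?T ?Q ?\<nu> \<epsilon> \<le> Suc (mixing_time X ?K ?\<mu> \<epsilon>)"
    unfolding mixing_time_def by (rule Least_le_Suc_Least, rule t) (rule order.trans[OF QK])
  \<comment> \<open>Here the witness that the dual mixing time is attained is \<open>Suc t\<close>,
    obtained from \<open>t\<close> by \<open>QK\<close>.\<close>
  moreover have "mixing_time X ?K ?\<mu> \<epsilon> \<le> Suc (mixing_time ?T ?Q ?\<nu> \<epsilon>)"
    unfolding mixing_time_def
    by (rule Least_le_Suc_Least, rule order.trans[OF QK t]) (rule order.trans[OF KQ])
  ultimately show ?thesis
    by linarith
qed

end
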